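(* For every connected multigraph $H$ there exist infinitely many (pairwise non-isomorphic) nontrivial $H$-irregular multigraphs.
   Context: A multigraph here is a finite undirected graph, in which loops and multiple (parallel) edges are allowed, that contains at least one loop or at least one multiple edge (so a simple graph is not a multigraph). Parallel edges, and different loops at the same vertex, are regarded as distinct edges; a subgraph is given by a subset of vertices together with a subset of the edges whose endpoints lie in it. A multigraph is nontrivial if it has more than one vertex. For a multigraph $H$, a multigraph $M$ and a vertex $v\in V(M)$, the $H$-degree of $v$ in $M$ is the number of subgraphs of $M$ that are isomorphic to $H$ and contain $v$. The multigraph $M$ is $H$-irregular if the $H$-degrees of its vertices are pairwise distinct. $H$ may have any number of vertices $\ge 1$. *)

theory Defs
  imports Main
begin

text \<open>
  Finite undirected graphs with loops and parallel edges. Edges are objects of their own, so that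
  parallel edges and different loops at one vertex are distinct; \<open>ends G e\<close> is the set of
  endpoints of \<open>e\<close>, a singleton exactly when \<open>e\<close> is a loop. The values of \<open>ends\<close> outside
  \<open>edges G\<close> carry no meaning.
\<close>

record ('v, 'e) mgraph =
  verts :: "'v set"
  edges :: "'e set"
  ends :: "'e \<Rightarrow> 'v set"

definition fin_graph :: "('v, 'e) mgraph \<Rightarrow> bool" where
  "fin_graph G \<longleftrightarrow> finite (verts G) \<and> finite (edges G) \<and>
     (\<forall>e\<in>edges G. ends G e \<subseteq> verts G \<and> card (ends G e) \<in> {1, 2})"

definition has_loop :: "('v, 'e) mgraph \<Rightarrow> bool" where
  "has_loop G \<longleftrightarrow> (\<exists>e\<in>edges G. card (ends G e) = 1)"

definition has_multiple_edge :: "('v, 'e) mgraph \<Rightarrow> bool" where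
  "has_multiple_edge G \<longleftrightarrow> (\<exists>e\<in>edges G. \<exists>f\<in>edges G. e \<noteq> f \<and> ends G e = ends G f)"

definition multigraph :: "('v, 'e) mgraph \<Rightarrow> bool" where
  "multigraph G \<longleftrightarrow> fin_graph G \<and> (has_loop G \<or> has_multiple_edge G)"

definition nontrivial :: "('v, 'e) mgraph \<Rightarrow> bool" where
  "nontrivial G \<longleftrightarrow> card (verts G) > 1"

definition adjacent :: "('v, 'e) mgraph \<Rightarrow> 'v \<Rightarrow> 'v \<Rightarrow> bool" where
  "adjacent G u v \<longleftrightarrow> (\<exists>e\<in>edges G. ends G e = {u, v})"

definition connected_graph :: "('v, 'e) mgraph \<Rightarrow> bool" where
  "connected_graph G \<longleftrightarrow>
     verts G \<noteq> {} \<and> (\<forall>u\<in>verts G. \<forall>v\<in>verts G. (adjacent G)\<^sup>*\<^sup>* u v)"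

definition isomorphic :: "('v, 'e) mgraph \<Rightarrow> ('w, 'f) mgraph \<Rightarrow> bool" where
  "isomorphic G H \<longleftrightarrow> (\<exists>\<phi> \<psi>. bij_betw \<phi> (verts G) (verts H) \<and> bij_betw \<psi> (edges G) (edges H) \<and>
     (\<forall>e\<in>edges G. ends H (\<psi> e) = \<phi> ` ends G e))"

text \<open>
  A subgraph of \<open>G\<close> is given by a pair of a vertex set and an edge set; counting such pairs rather
  than records keeps the irrelevant values of \<open>ends\<close> out of the count.
\<close>

definition subgraph_pair :: "'v set \<Rightarrow> 'e set \<Rightarrow> ('v, 'e) mgraph \<Rightarrow> bool" where
  "subgraph_pair W F G \<longleftrightarrow> W \<subseteq> verts G \<and> F \<subseteq> edges G \<and> (\<forall>e\<in>F. ends G e \<subseteq> W)"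

definition H_degree :: "('a, 'b) mgraph \<Rightarrow> ('v, 'e) mgraph \<Rightarrow> 'v \<Rightarrow> nat" where
  "H_degree H M v = card {(W, F). subgraph_pair W F M \<and> v \<in> W \<and>
     isomorphic \<lparr>verts = W, edges = F, ends = ends M\<rparr> H}"

definition H_irregular :: "('a, 'b) mgraph \<Rightarrow> ('v, 'e) mgraph \<Rightarrow> bool" where
  "H_irregular H M \<longleftrightarrow> inj_on (H_degree H M) (verts M)"

end

theory Submission
  imports Defs "HOL-Library.Countable"
begin

text \<open>
  Let \<open>n\<close> be the number of vertices of \<open>H\<close> and let \<open>M\<close> have the vertices \<open>0, \<dots>, n\<close>, with
  \<open>K + i + j\<close> edges joining \<open>i\<close> and \<open>j\<close> (loops if \<open>i = j\<close>), where \<open>K\<close> is at least the number of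
  edges of \<open>H\<close>. Replacing \<open>v\<close> by \<open>v + 1\<close> maps the copies of \<open>H\<close> that contain \<open>v\<close> but not \<open>v + 1\<close>
  injectively to those that contain \<open>v + 1\<close> but not \<open>v\<close>. It misses every copy that uses the last of
  the parallel edges between \<open>v + 1\<close> and some vertex, and such copies exist because \<open>H\<close> has an edge
  and \<open>M\<close> has \<open>n\<close> vertices other than \<open>v\<close>. Hence the \<open>H\<close>-degree is strictly increasing in \<open>v\<close>.
\<close>

section \<open>Isomorphisms of multigraphs\<close>

text \<open>The inverse vertex bijection undoes \<phi> only inside \<open>verts G\<close>; the
  second assumption puts the endpoint sets there.\<close>

lemma isomorphic_sym:
  assumes "isomorphic G H" and "\<And>e. e \<in> edges G \<Longrightarrow> ends G e \<subseteq> verts G"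
  shows "isomorphic H G"
proof -
  obtain \<phi> \<psi> where \<phi>: "bij_betw \<phi> (verts G) (verts H)" and \<psi>: "bij_betw \<psi> (edges G) (edges H)"
    and ends: "\<forall>e\<in>edges G. ends H (\<psi> e) = \<phi> ` ends G e"
    using assms(1) unfolding isomorphic_def by blast
  have "ends G (inv_into (edges G) \<psi> f) = inv_into (verts G) \<phi> ` ends H f" if f: "f \<in> edges H" for f
  proof -
    obtain e where e: "e \<in> edges G" "f = \<psi> e"
      using f bij_betw_imp_surj_on[OF \<psi>] by blast
    then have "inv_into (verts G) \<phi> ` ends H f = ends G e"
      using ends \<phi> assms(2) by (simp add: bij_betw_def inv_into_image_cancel)
    then show ?thesis
      using e \<psi> by (simp add: bij_betw_def)
  qed
  then show ?thesis
    unfolding isomorphic_def using bij_betw_inv_into[OF \<phi>] bij_betw_inv_into[OF \<psi>] by blast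
qed

lemma isomorphic_trans:
  assumes "isomorphic G H" and "isomorphic H L"
  shows "isomorphic G L"
proof -
  obtain \<phi> \<psi> where 1: "bij_betw \<phi> (verts G) (verts H)" "bij_betw \<psi> (edges G) (edges H)"
    "\<forall>e\<in>edges G. ends H (\<psi> e) = \<phi> ` ends G e"
    using assms(1) unfolding isomorphic_def by blast
  obtain \<phi>' \<psi>' where 2: "bij_betw \<phi>' (verts H) (verts L)" "bij_betw \<psi>' (edges H) (edges L)"
    "\<forall>e\<in>edges H. ends L (\<psi>' e) = \<phi>' ` ends H e"
    using assms(2) unfolding isomorphic_def by blast
  have "\<forall>e\<in>edges G. ends L ((\<psi>' \<circ> \<psi>) e) = (\<phi>' \<circ> \<phi>) ` ends G e"
    using 1 2 bij_betwE by (fastforce simp: image_comp)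
  then show ?thesis
    unfolding isomorphic_def
    using bij_betw_trans[OF 1(1) 2(1)] bij_betw_trans[OF 1(2) 2(2)] by blast
qed

lemma isomorphic_card_edges: "isomorphic G H \<Longrightarrow> card (edges G) = card (edges H)"
  unfolding isomorphic_def using bij_betw_same_card by blast

section \<open>The staircase multigraphs\<close>

text \<open>An edge is the code of a triple: its endpoints and its index among its parallel edges.
  Coding by \<open>to_nat\<close> keeps the edge type \<open>nat\<close>, and requiring
  \<open>i \<le> j\<close> lists every unordered pair once. The multiplicity grows strictly with
  each endpoint.\<close>

definition staircase :: "nat \<Rightarrow> nat \<Rightarrow> (nat, nat) mgraph" where
  "staircase n K = \<lparr>verts = {..n},
     edges = to_nat ` {(i, j, t :: nat). i \<le> j \<and> j \<le> n \<and> t < K + i + j},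
     ends = (\<lambda>e. case from_nat e of (i, j, t :: nat) \<Rightarrow> {i, j})\<rparr>"

lemma verts_staircase [simp]: "verts (staircase n K) = {..n}"
  by (simp add: staircase_def)

lemma edges_staircase:
  "edges (staircase n K) = to_nat ` {(i, j, t :: nat). i \<le> j \<and> j \<le> n \<and> t < K + i + j}"
  by (simp add: staircase_def)

lemma to_nat_in_edges_staircase [simp]:
  "to_nat (i, j, t :: nat) \<in> edges (staircase n K) \<longleftrightarrow> i \<le> j \<and> j \<le> n \<and> t < K + i + j"
  by (auto simp: edges_staircase)

lemma ends_staircase [simp]: "ends (staircase n K) (to_nat (i, j, t :: nat)) = {i, j}"
  by (simp add: staircase_def)

lemma edges_staircaseE:
  assumes "e \<in> edges (staircase n K)"
  obtains i j t where "e = to_nat (i, j, t :: nat)" "i \<le> j" "j \<le> n" "t < K + i + j"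
  using assms by (auto simp: edges_staircase)

lemma finite_edges_staircase: "finite (edges (staircase n K))"
proof -
  have "{(i, j, t). i \<le> j \<and> j \<le> n \<and> t < K + i + j} \<subseteq> {..n} \<times> {..n} \<times> {..<K + n + n}"
    by auto
  then show ?thesis
    unfolding edges_staircase by (intro finite_imageI) (rule finite_subset, auto)
qed

lemma multigraph_staircase:
  assumes "0 < K"
  shows "multigraph (staircase n K)"
proof -
  have "card {i, j} \<in> {1, 2}" for i j :: nat
    by (cases "i = j") simp_all
  then have "fin_graph (staircase n K)"
    unfolding fin_graph_def by (fastforce simp: finite_edges_staircase elim!: edges_staircaseE)
  moreover have "has_loop (staircase n K)"
    unfolding has_loop_def using assms by (intro bexI[of _ "to_nat (0::nat, 0::nat, 0::nat)"]) simp_all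
  ultimately show ?thesis
    by (simp add: multigraph_def)
qed

lemma card_edges_staircase_less:
  assumes "K < K'"
  shows "card (edges (staircase n K)) < card (edges (staircase n K'))"
proof (rule psubset_card_mono[OF finite_edges_staircase])
  have "to_nat (0::nat, 0::nat, K) \<in> edges (staircase n K') - edges (staircase n K)"
    using assms by simp
  moreover have "edges (staircase n K) \<subseteq> edges (staircase n K')"
    using assms by (auto elim!: edges_staircaseE)
  ultimately show "edges (staircase n K) \<subset> edges (staircase n K')"
    by blast
qed

section \<open>Copies of \<open>H\<close> and their images\<close>

definition copies :: "('a, 'b) mgraph \<Rightarrow> ('v, 'e) mgraph \<Rightarrow> ('v set \<times> 'e set) set" where
  "copies H M = {(W, F). subgraph_pair W F M \<and> isomorphic \<lparr>verts = W, edges = F, ends = ends M\<rparr> H}"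

lemma H_degree_eq_card_copies: "H_degree H M v = card {C \<in> copies H M. v \<in> fst C}"
  unfolding H_degree_def copies_def by (rule arg_cong[where f = card]) auto

lemma finite_copies:
  assumes "finite (verts M)" and "finite (edges M)"
  shows "finite (copies H M)"
proof (rule finite_subset)
  show "copies H M \<subseteq> Pow (verts M) \<times> Pow (edges M)"
    unfolding copies_def subgraph_pair_def by blast
qed (use assms in simp)

text \<open>The two maps give an isomorphism from the old copy to its image; reversing it and
  composing leads from the image to \<open>H\<close>. The lemma serves both to move copies inside a
  staircase and, with \<open>M = H\<close>, to embed \<open>H\<close> in one.\<close>

lemma copies_image:
  assumes C: "(W, F) \<in> copies H M"
    and \<sigma>: "inj_on \<sigma> W" "\<sigma> ` W \<subseteq> verts N"
    and \<tau>: "inj_on \<tau> F" "\<tau> ` F \<subseteq> edges N"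
    and ends: "\<And>e. e \<in> F \<Longrightarrow> ends N (\<tau> e) = \<sigma> ` ends M e"
  shows "(\<sigma> ` W, \<tau> ` F) \<in> copies H N"
proof -
  have W: "ends M e \<subseteq> W" if "e \<in> F" for e
    using C that by (auto simp: copies_def subgraph_pair_def)
  have "isomorphic \<lparr>verts = W, edges = F, ends = ends M\<rparr>
    \<lparr>verts = \<sigma> ` W, edges = \<tau> ` F, ends = ends N\<rparr>"
    unfolding isomorphic_def
    by (rule exI[of _ \<sigma>], rule exI[of _ \<tau>]) (simp add: \<sigma> \<tau> ends inj_on_imp_bij_betw)
  then have "isomorphic \<lparr>verts = \<sigma> ` W, edges = \<tau> ` F, ends = ends N\<rparr>
    \<lparr>verts = W, edges = F, ends = ends M\<rparr>"
    by (rule isomorphic_sym) (simp add: W)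
  then have "isomorphic \<lparr>verts = \<sigma> ` W, edges = \<tau> ` F, ends = ends N\<rparr> H"
    using C isomorphic_trans by (fastforce simp: copies_def)
  moreover have "subgraph_pair (\<sigma> ` W) (\<tau> ` F) N"
    unfolding subgraph_pair_def using \<sigma> \<tau> ends W by (auto simp: image_mono)
  ultimately show ?thesis
    by (simp add: copies_def)
qed

lemma self_in_copies:
  assumes "fin_graph H"
  shows "(verts H, edges H) \<in> copies H H"
proof -
  have "isomorphic \<lparr>verts = verts H, edges = edges H, ends = ends H\<rparr> H"
    unfolding isomorphic_def by (rule exI[of _ id], rule exI[of _ id]) simp
  then show ?thesis
    using assms by (simp add: copies_def subgraph_pair_def fin_graph_def)
qed

section \<open>Shifting copies from \<open>v\<close> to \<open>v + 1\<close>\<close>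

text \<open>This merges \<open>v\<close> with \<open>Suc v\<close> instead of swapping them, since a
  swap could send an edge at \<open>Suc v\<close> to an index that does not exist at
  \<open>v\<close>. It is applied only to copies that avoid \<open>Suc v\<close>, where it is
  injective.\<close>

definition lift_vert :: "nat \<Rightarrow> nat \<Rightarrow> nat" where
  "lift_vert v i = (if i = v then Suc v else i)"

definition lift_edge :: "nat \<Rightarrow> nat \<Rightarrow> nat" where
  "lift_edge v e = (case from_nat e of (i, j, t :: nat) \<Rightarrow> to_nat (lift_vert v i, lift_vert v j, t))"

lemma lift_edge_to_nat [simp]:
  "lift_edge v (to_nat (i, j, t :: nat)) = to_nat (lift_vert v i, lift_vert v j, t)"
  by (simp add: lift_edge_def)

lemma inj_on_lift_vert: "inj_on (lift_vert v) (- {Suc v})"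
  by (auto simp: inj_on_def lift_vert_def split: if_splits)

lemma inj_on_lift_edge:
  "inj_on (lift_edge v) {e \<in> edges (staircase n K). Suc v \<notin> ends (staircase n K) e}"
  by (auto simp: inj_on_def lift_vert_def elim!: edges_staircaseE split: if_splits)

text \<open>Codes stay valid: no number lies strictly between \<open>v\<close> and
  \<open>Suc v\<close>, so the order of the endpoints survives, and the multiplicities do not
  decrease, so the index \<open>t\<close> can be kept.\<close>

lemma copies_lift:
  assumes C: "(W, F) \<in> copies H (staircase n K)" and v: "Suc v \<notin> W" "v < n"
  shows "(lift_vert v ` W, lift_edge v ` F) \<in> copies H (staircase n K)"
proof (rule copies_image[OF C])
  have W: "W \<subseteq> {..n}" and F: "F \<subseteq> {e \<in> edges (staircase n K). Suc v \<notin> ends (staircase n K) e}"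
    using C v by (auto simp: copies_def subgraph_pair_def)
  show "inj_on (lift_vert v) W"
    by (rule inj_on_subset[OF inj_on_lift_vert]) (use v in auto)
  show "inj_on (lift_edge v) F"
    by (rule inj_on_subset[OF inj_on_lift_edge F])
  show "lift_vert v ` W \<subseteq> verts (staircase n K)"
    using W v by (auto simp: lift_vert_def)
  show "lift_edge v ` F \<subseteq> edges (staircase n K)"
    using F v by (fastforce simp: lift_vert_def elim!: edges_staircaseE)
  show "ends (staircase n K) (lift_edge v e) = lift_vert v ` ends (staircase n K) e" if "e \<in> F" for e
    using F that by (auto elim!: edges_staircaseE)
qed

text \<open>An endpoint \<open>x\<close> of \<open>e\<^sub>0\<close> is placed on
  \<open>Suc v\<close>, and the other vertices of \<open>H\<close> fill all remaining places except
  \<open>v\<close>. Then \<open>e\<^sub>0\<close> can take the last index of its pair, while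
  \<open>K\<close> leaves room for all other edges below it.\<close>

lemma copy_using_last_edge:
  assumes H: "fin_graph H" "e\<^sub>0 \<in> edges H" and v: "v < card (verts H)" and K: "card (edges H) \<le> K"
  obtains W F i j where "(W, F) \<in> copies H (staircase (card (verts H)) K)" "v \<notin> W"
    "Suc v \<in> {i, j}" "to_nat (i, j, K + i + j - 1) \<in> F"
proof -
  let ?n = "card (verts H)"
  have fin: "finite (verts H)" "finite (edges H)"
    using H by (auto simp: fin_graph_def)
  have ends: "\<exists>x y. ends H e = {x, y}" "ends H e \<subseteq> verts H" if "e \<in> edges H" for e
    using H(1) that unfolding fin_graph_def
    by (metis card_1_singletonE card_2_iff insert_absorb2 insertE singletonD)+
  obtain x where x: "x \<in> ends H e\<^sub>0" "x \<in> verts H"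
    using ends[OF H(2)] by blast
  \<comment> \<open>Both sides are \<open>?n - 1\<close>, because \<open>{..?n}\<close> has
    \<open>?n + 1\<close> elements.\<close>
  have "card (verts H - {x}) = card ({..?n} - {v, Suc v})"
    using x fin v by (simp add: card_Diff_subset)
  then obtain \<phi>\<^sub>0 where "bij_betw \<phi>\<^sub>0 (verts H - {x}) ({..?n} - {v, Suc v})"
    using fin by (meson finite_Diff finite_atMost finite_same_card_bij)
  define \<phi> where "\<phi> = \<phi>\<^sub>0(x := Suc v)"
  have \<phi>x: "\<phi> x = Suc v"
    by (simp add: \<phi>_def)
  have "bij_betw \<phi> (verts H - {x}) ({..?n} - {v, Suc v})"
    using \<open>bij_betw \<phi>\<^sub>0 _ _\<close> by (subst bij_betw_cong[where g = \<phi>\<^sub>0]) (auto simp: \<phi>_def)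
  then have "bij_betw \<phi> (verts H - {x} \<union> {x}) ({..?n} - {v, Suc v} \<union> {\<phi> x})"
    by (intro notIn_Un_bij_betw) (simp_all add: \<phi>x)
  moreover have "verts H - {x} \<union> {x} = verts H" "{..?n} - {v, Suc v} \<union> {\<phi> x} = {..?n} - {v}"
    using x v by (auto simp: \<phi>x)
  ultimately have \<phi>: "bij_betw \<phi> (verts H) ({..?n} - {v})"
    by simp
  obtain \<iota> where \<iota>: "bij_betw \<iota> (edges H) {0..<card (edges H)}"
    using ex_bij_betw_finite_nat[OF fin(2)] by blast
  define lo where "lo e = Min (\<phi> ` ends H e)" for e
  define hi where "hi e = Max (\<phi> ` ends H e)" for e
  \<comment> \<open>The numbering \<iota> of all edges of \<open>H\<close> stays below
    \<open>K\<close>, so it gives distinct indices whatever the endpoints are.\<close>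
  define t where "t e = (if e = e\<^sub>0 then K + lo e + hi e - 1 else \<iota> e)" for e
  define \<psi> where "\<psi> e = to_nat (lo e, hi e, t e)" for e
  have lohi: "{lo e, hi e} = \<phi> ` ends H e" "lo e \<le> hi e" "hi e \<le> ?n" if e: "e \<in> edges H" for e
  proof -
    obtain a b where ab: "ends H e = {a, b}"
      using ends(1)[OF e] by blast
    then show "{lo e, hi e} = \<phi> ` ends H e" "lo e \<le> hi e"
      by (auto simp: lo_def hi_def min_def max_def)
    have "\<phi> a \<le> ?n" "\<phi> b \<le> ?n"
      using ends(2)[OF e] \<phi> ab by (auto simp: bij_betw_def)
    then show "hi e \<le> ?n"
      using ab by (simp add: hi_def)
  qed
  have v0: "Suc v \<in> {lo e\<^sub>0, hi e\<^sub>0}"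
    unfolding lohi(1)[OF H(2)] using x \<phi>x by force
  \<comment> \<open>As \<open>Suc v\<close> is an endpoint of the image of \<open>e\<^sub>0\<close>,
    the sum \<open>lo e\<^sub>0 + hi e\<^sub>0\<close> is positive. So the subtraction of 1 does not
    truncate, and the index of \<open>e\<^sub>0\<close> is at least \<open>K\<close>, unlike all
    others.\<close>
  have t: "t e < K + lo e + hi e" "t e < K \<longleftrightarrow> e \<noteq> e\<^sub>0" if "e \<in> edges H" for e
    using bij_betwE[OF \<iota>] that K v0 by (fastforce simp: t_def)+
  have "(\<phi> ` verts H, \<psi> ` edges H) \<in> copies H (staircase ?n K)"
  proof (rule copies_image[OF self_in_copies[OF H(1)]])
    show "inj_on \<phi> (verts H)" "\<phi> ` verts H \<subseteq> verts (staircase ?n K)"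
      using \<phi> by (auto simp: bij_betw_def)
    show "inj_on \<psi> (edges H)"
    proof (rule inj_onI)
      fix e f assume ef: "e \<in> edges H" "f \<in> edges H" "\<psi> e = \<psi> f"
      then have "t e = t f"
        by (simp add: \<psi>_def)
      then show "e = f"
        using t(2) ef \<iota> by (metis t_def bij_betw_def inj_onD)
    qed
    show "\<psi> ` edges H \<subseteq> edges (staircase ?n K)"
      using lohi t by (auto simp: \<psi>_def)
    show "ends (staircase ?n K) (\<psi> e) = \<phi> ` ends H e" if "e \<in> edges H" for e
      using lohi(1)[OF that] by (simp add: \<psi>_def)
  qed
  moreover have "v \<notin> \<phi> ` verts H"
    using \<phi> by (simp add: bij_betw_def)
  moreover have "to_nat (lo e\<^sub>0, hi e\<^sub>0, K + lo e\<^sub>0 + hi e\<^sub>0 - 1) \<in> \<psi> ` edges H"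
    using H(2) by (auto simp: \<psi>_def t_def)
  ultimately show thesis
    using that v0 by blast
qed

lemma H_degree_staircase_less_Suc:
  assumes H: "fin_graph H" "edges H \<noteq> {}" and v: "v < card (verts H)" and K: "card (edges H) \<le> K"
  shows "H_degree H (staircase (card (verts H)) K) v < H_degree H (staircase (card (verts H)) K) (Suc v)"
proof -
  define M where "M = staircase (card (verts H)) K"
  \<comment> \<open>Copies containing both vertices (\<open>AB\<close>) count equally in the two
    degrees, so it remains to compare \<open>A\<close> with \<open>B\<close>.\<close>
  define A where "A = {C \<in> copies H M. v \<in> fst C \<and> Suc v \<notin> fst C}"
  define B where "B = {C \<in> copies H M. Suc v \<in> fst C \<and> v \<notin> fst C}"
  define AB where "AB = {C \<in> copies H M. v \<in> fst C \<and> Suc v \<in> fst C}"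
  define \<Phi> where "\<Phi> = map_prod (image (lift_vert v)) (image (lift_edge v))"
  have fin: "finite (copies H M)"
    by (rule finite_copies) (simp_all add: M_def finite_edges_staircase)
  have F: "F \<subseteq> {e \<in> edges M. Suc v \<notin> ends M e}" if "(W, F) \<in> A" for W F
    using that by (auto simp: A_def copies_def subgraph_pair_def)
  have "inj_on \<Phi> A"
  proof (rule inj_onI, clarify)
    fix W F W' F' assume C: "(W, F) \<in> A" "(W', F') \<in> A" and eq: "\<Phi> (W, F) = \<Phi> (W', F')"
    have "W = W'"
      by (rule inj_on_image_eq_iff[OF inj_on_lift_vert[of v], THEN iffD1])
        (use C eq in \<open>auto simp: A_def \<Phi>_def\<close>)
    moreover have "F = F'"
      using eq inj_on_image_eq_iff[OF inj_on_lift_edge F[OF C(1), unfolded M_def] F[OF C(2), unfolded M_def]]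
      by (simp add: \<Phi>_def)
    ultimately show "W = W' \<and> F = F'" ..
  qed
  moreover have "\<Phi> ` A \<subset> B"
  proof
    show "\<Phi> ` A \<subseteq> B"
      using copies_lift v by (fastforce simp: A_def B_def \<Phi>_def M_def lift_vert_def split: if_splits)
    obtain e\<^sub>0 where "e\<^sub>0 \<in> edges H"
      using H by blast
    then obtain W F i j where C: "(W, F) \<in> copies H M" "v \<notin> W" "Suc v \<in> {i, j}"
      "to_nat (i, j, K + i + j - 1) \<in> F"
      using copy_using_last_edge[OF H(1) _ v K] unfolding M_def by blast
    then have "{i, j} \<subseteq> W"
      by (fastforce simp: copies_def subgraph_pair_def M_def dest: bspec)
    then have "(W, F) \<in> B"
      using C by (auto simp: B_def)
    moreover have "(W, F) \<notin> \<Phi> ` A"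
    proof
      assume "(W, F) \<in> \<Phi> ` A"
      then obtain W' F' where C': "(W', F') \<in> A" "F = lift_edge v ` F'"
        by (auto simp: \<Phi>_def)
      then obtain e where e: "e \<in> edges M" "Suc v \<notin> ends M e" "to_nat (i, j, K + i + j - 1) = lift_edge v e"
        using F C(4) by blast
      \<comment> \<open>A preimage edge has \<open>v\<close> wherever the lifted one has
        \<open>Suc v\<close>, so \<open>i' + j' < i + j\<close>. Its index is below
        \<open>K + i' + j'\<close>, hence below \<open>K + i + j - 1\<close>, yet lifting preserves
        the index.\<close>
      obtain i' j' t where "e = to_nat (i', j', t)" "t < K + i' + j'"
        using e(1) unfolding M_def by (rule edges_staircaseE)
      with e C(3) show False
        by (auto simp: M_def lift_vert_def split: if_splits)
    qed
    ultimately show "\<Phi> ` A \<noteq> B"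
      by blast
  qed
  moreover have "finite B"
    using fin by (simp add: B_def)
  ultimately have "card A < card B"
    by (metis card_image psubset_card_mono)
  moreover have "{C \<in> copies H M. v \<in> fst C} = AB \<union> A" "AB \<inter> A = {}"
    "{C \<in> copies H M. Suc v \<in> fst C} = AB \<union> B" "AB \<inter> B = {}"
    by (auto simp: A_def B_def AB_def)
  moreover have "finite A" "finite AB"
    using fin by (simp_all add: A_def AB_def)
  ultimately show ?thesis
    unfolding H_degree_eq_card_copies M_def[symmetric] using \<open>finite B\<close> by (simp add: card_Un_disjoint)
qed

section \<open>Irregularity and the infinite family\<close>

lemma H_irregular_staircase:
  assumes H: "fin_graph H" "edges H \<noteq> {}" and K: "card (edges H) \<le> K"
  shows "H_irregular H (staircase (card (verts H)) K)"
proof -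
  let ?d = "H_degree H (staircase (card (verts H)) K)"
  have less: "?d u < ?d v" if "u < v" "v \<le> card (verts H)" for u v
    using that
  proof (induction v)
    case (Suc v)
    then have "?d v < ?d (Suc v)"
      using H_degree_staircase_less_Suc[OF H _ K] by simp
    with Suc show ?case
      by (cases "u = v") auto
  qed simp
  show ?thesis
    unfolding H_irregular_def by (rule linorder_inj_onI) (use less in force)+
qed

theorem mainTheorem2:
  fixes H :: "('a, 'b) mgraph"
  assumes "multigraph H" and "connected_graph H"
  shows "\<exists>S :: (nat, nat) mgraph set. infinite S \<and>
    (\<forall>M\<in>S. multigraph M \<and> nontrivial M \<and> H_irregular H M) \<and>
    pairwise (\<lambda>M N. \<not> isomorphic M N) S"
proof -
  let ?M = "staircase (card (verts H))"
  let ?S = "?M ` {card (edges H)..}"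
  have H: "fin_graph H" "edges H \<noteq> {}"
    using assms(1) by (auto simp: multigraph_def has_loop_def has_multiple_edge_def)
  \<comment> \<open>A positive edge count makes \<open>K\<close> positive, which gives the staircase
    its loop at 0; a nonempty vertex set gives it at least two vertices.\<close>
  then have pos: "0 < card (edges H)" "0 < card (verts H)"
    using assms(2) by (auto simp: fin_graph_def connected_graph_def card_gt_0_iff)
  \<comment> \<open>The number of edges is an isomorphism invariant and increases strictly with
    \<open>K\<close>.\<close>
  have eq: "K = K'" if "isomorphic (?M K) (?M K')" for K K'
    using isomorphic_card_edges[OF that] card_edges_staircase_less by (metis nat_neq_iff)
  have "inj ?M"
    by (rule injI) (metis card_edges_staircase_less nat_neq_iff)
  then have "infinite ?S"
    by (simp add: finite_image_iff inj_on_subset infinite_Ici)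
  moreover have "\<forall>M\<in>?S. multigraph M \<and> nontrivial M \<and> H_irregular H M"
    using pos multigraph_staircase H_irregular_staircase[OF H] by (auto simp: nontrivial_def)
  moreover have "pairwise (\<lambda>M N. \<not> isomorphic M N) ?S"
    using eq by (auto simp: pairwise_def)
  ultimately show ?thesis
    by blast
qed

end
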